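(* For every monadically stable class $\mathscr{C}$ of structures and every finite set $\Phi(x,\bar y)$ of formulas, where $x$ is a single variable, there exist integers $n_0$ and $k$ such that for every $\mathbb{A}\in\mathscr{C}$ the following holds. If $I=(\bar a_i)_{1\le i\le n}$ is a $\Delta^\Phi_k$-indiscernible sequence of $|\bar y|$-tuples in $\mathbb{A}$ of length $n\ge n_0$ and $a\in\mathbb{A}$, then there exist an index $\mathrm{ex}(a)\in[n]$ and a $\Phi$-type $\tau$ such that $\mathbb{A}\models\tau(a,\bar a_i)$ for all $i\in[n]$ with $i\neq\mathrm{ex}(a)$.
   Context: Structures are over a fixed relational signature $\Sigma$ and may be finite or infinite. A formula $\psi(\bar x,\bar y)$ has the $k$-order property on a class $\mathscr{D}$ if there are $\mathbb{A}\in\mathscr{D}$ and tuples $(\bar a_i)_{i\in[k]},(\bar b_i)_{i\in[k]}$ with $\mathbb{A}\models\psi(\bar a_i,\bar b_j)$ iff $i\le j$; $\mathscr{D}$ is stable if no first-order formula has the $k$-order property on $\mathscr{D}$ for all $k$. $\mathscr{C}$ is monadically stable if for every extension $\Sigma^+$ of $\Sigma$ by unary predicates, the class of all $\Sigma^+$-expansions of structures from $\mathscr{C}$ is stable. A sequence $(\bar a_i)_{1\le i\le n}$ of equal-length tuples is $\gamma$-indiscernible for $\gamma(\bar x_1,\dots,\bar x_m)$ if for any $i_1<\dots<i_m$ and $j_1<\dots<j_m$ in $[n]$, $\mathbb{A}\models\gamma(\bar a_{i_1},\dots,\bar a_{i_m})$ iff $\mathbb{A}\models\gamma(\bar a_{j_1},\dots,\bar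 a_{j_m})$; $\Delta$-indiscernible means $\gamma$-indiscernible for all $\gamma\in\Delta$. For a finite set $\Phi(x,\bar y)$ of formulas with $x$ a single variable and $k\in\mathbb{N}$, $\Delta^\Phi_k$ is the set of all formulas $\exists x.\bigwedge_{j\in[i]}\phi_j(x,\bar y_j)$ with $i\le k$ and each $\phi_j$ a boolean combination of formulas from $\Phi$. A $\Phi$-type is a formula $\bigwedge_{\phi\in A}\phi(x,\bar y)\wedge\bigwedge_{\phi\in\Phi\setminus A}\neg\phi(x,\bar y)$ for some $A\subseteq\Phi$. *)

theory Defs
  imports Main
begin

record 'r signature =
  symbols :: "'r set"
  arity :: "'r \<Rightarrow> nat"

record ('a, 'r) struct =
  universe :: "'a set"
  interp :: "'r \<Rightarrow> 'a list set"

text \<open>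
  Symbols outside the signature are interpreted by the empty relation, so that two structures
  over the same signature are equal iff they have the same universe and the same relations.
\<close>

definition structure_over :: "'r signature \<Rightarrow> ('a, 'r) struct \<Rightarrow> bool" where
  "structure_over \<Sigma> M \<longleftrightarrow>
     (\<forall>r \<in> symbols \<Sigma>. interp M r \<subseteq> {t. length t = arity \<Sigma> r \<and> set t \<subseteq> universe M}) \<and>
     (\<forall>r. r \<notin> symbols \<Sigma> \<longrightarrow> interp M r = {})"

definition tuples :: "('a, 'r) struct \<Rightarrow> nat \<Rightarrow> 'a list set" where
  "tuples M q = {t. length t = q \<and> set t \<subseteq> universe M}"

text \<open>
  First-order formulas with equality; variables are de Bruijn indices into the list of values.
  Disjunction and the universal quantifier are expressed through the given connectives.
\<close>

datatype 'r fm =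
    Top
  | Eq nat nat
  | Rel 'r "nat list"
  | Neg "'r fm"
  | Conj "'r fm" "'r fm"
  | Ex "'r fm"

primrec sat :: "('a, 'r) struct \<Rightarrow> 'a list \<Rightarrow> 'r fm \<Rightarrow> bool" where
  "sat M e Top \<longleftrightarrow> True"
| "sat M e (Eq v w) \<longleftrightarrow> e ! v = e ! w"
| "sat M e (Rel r vs) \<longleftrightarrow> map ((!) e) vs \<in> interp M r"
| "sat M e (Neg \<phi>) \<longleftrightarrow> \<not> sat M e \<phi>"
| "sat M e (Conj \<phi> \<psi>) \<longleftrightarrow> sat M e \<phi> \<and> sat M e \<psi>"
| "sat M e (Ex \<phi>) \<longleftrightarrow> (\<exists>x \<in> universe M. sat M (x # e) \<phi>)"

text \<open>\<open>fm_over \<Sigma> n \<phi>\<close>: \<open>\<phi>\<close> is a well-formed formula over \<open>\<Sigma>\<close> with free variables among \<open>0, \<dots>, n - 1\<close>.\<close>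

primrec fm_over :: "'r signature \<Rightarrow> nat \<Rightarrow> 'r fm \<Rightarrow> bool" where
  "fm_over \<Sigma> n Top \<longleftrightarrow> True"
| "fm_over \<Sigma> n (Eq v w) \<longleftrightarrow> v < n \<and> w < n"
| "fm_over \<Sigma> n (Rel r vs) \<longleftrightarrow> r \<in> symbols \<Sigma> \<and> length vs = arity \<Sigma> r \<and> (\<forall>v \<in> set vs. v < n)"
| "fm_over \<Sigma> n (Neg \<phi>) \<longleftrightarrow> fm_over \<Sigma> n \<phi>"
| "fm_over \<Sigma> n (Conj \<phi> \<psi>) \<longleftrightarrow> fm_over \<Sigma> n \<phi> \<and> fm_over \<Sigma> n \<psi>"
| "fm_over \<Sigma> n (Ex \<phi>) \<longleftrightarrow> fm_over \<Sigma> (Suc n) \<phi>"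

primrec rename :: "(nat \<Rightarrow> nat) \<Rightarrow> 'r fm \<Rightarrow> 'r fm" where
  "rename f Top = Top"
| "rename f (Eq v w) = Eq (f v) (f w)"
| "rename f (Rel r vs) = Rel r (map f vs)"
| "rename f (Neg \<phi>) = Neg (rename f \<phi>)"
| "rename f (Conj \<phi> \<psi>) = Conj (rename f \<phi>) (rename f \<psi>)"
| "rename f (Ex \<phi>) = Ex (rename (case_nat 0 (\<lambda>v. Suc (f v))) \<phi>)"

definition Conjs :: "'r fm list \<Rightarrow> 'r fm" where
  "Conjs \<phi>s = foldr Conj \<phi>s Top"

text \<open>
  A formula \<open>\<psi>(x\<^sub>1, \<dots>, x\<^sub>p; y\<^sub>1, \<dots>, y\<^sub>q)\<close> uses the indices \<open>0, \<dots>, p - 1\<close> for the first tuple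
  and \<open>p, \<dots>, p + q - 1\<close> for the second.
\<close>

definition order_property ::
    "('a, 'r) struct set \<Rightarrow> nat \<Rightarrow> nat \<Rightarrow> 'r fm \<Rightarrow> nat \<Rightarrow> bool" where
  "order_property D p q \<psi> k \<longleftrightarrow>
     (\<exists>M \<in> D. \<exists>a b. (\<forall>i \<in> {1..k}. a i \<in> tuples M p \<and> b i \<in> tuples M q) \<and>
        (\<forall>i \<in> {1..k}. \<forall>j \<in> {1..k}. sat M (a i @ b j) \<psi> \<longleftrightarrow> i \<le> j))"

definition stable :: "'r signature \<Rightarrow> ('a, 'r) struct set \<Rightarrow> bool" where
  "stable \<Sigma> D \<longleftrightarrow>
     \<not> (\<exists>p q \<psi>. fm_over \<Sigma> (p + q) \<psi> \<and> (\<forall>k. order_property D p q \<psi> k))"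

definition unary_extension :: "'r signature \<Rightarrow> 'u set \<Rightarrow> ('r + 'u) signature" where
  "unary_extension \<Sigma> U =
     \<lparr>symbols = symbols \<Sigma> <+> U, arity = case_sum (arity \<Sigma>) (\<lambda>_. 1)\<rparr>"

definition reduct :: "('a, 'r + 'u) struct \<Rightarrow> ('a, 'r) struct" where
  "reduct M = \<lparr>universe = universe M, interp = (\<lambda>r. interp M (Inl r))\<rparr>"

definition expansions ::
    "('r + 'u) signature \<Rightarrow> ('a, 'r) struct set \<Rightarrow> ('a, 'r + 'u) struct set" where
  "expansions \<Sigma>' C = {M. structure_over \<Sigma>' M \<and> reduct M \<in> C}"

text \<open>
  The new predicates are named by natural numbers. This loses no extension: a violation of
  stability is witnessed by a single formula, in which only finitely many predicates occur.
\<close>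

definition monadically_stable :: "'r signature \<Rightarrow> ('a, 'r) struct set \<Rightarrow> bool" where
  "monadically_stable \<Sigma> C \<longleftrightarrow>
     (\<forall>U :: nat set. stable (unary_extension \<Sigma> U) (expansions (unary_extension \<Sigma> U) C))"

text \<open>
  A pair \<open>(m, \<gamma>)\<close> stands for a formula \<open>\<gamma>\<close> in \<open>m\<close> tuples of variables, numbered consecutively.
\<close>

definition indiscernible ::
    "('a, 'r) struct \<Rightarrow> nat \<Rightarrow> (nat \<Rightarrow> 'a list) \<Rightarrow> nat \<times> 'r fm \<Rightarrow> bool" where
  "indiscernible M n a = (\<lambda>(m, \<gamma>). \<forall>is js.
     length is = m \<and> sorted_wrt (<) is \<and> set is \<subseteq> {1..n} \<and>
     length js = m \<and> sorted_wrt (<) js \<and> set js \<subseteq> {1..n} \<longrightarrow>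
     (sat M (concat (map a is)) \<gamma> \<longleftrightarrow> sat M (concat (map a js)) \<gamma>))"

inductive_set bool_combs :: "'r fm set \<Rightarrow> 'r fm set" for \<Phi> :: "'r fm set" where
  base: "\<phi> \<in> \<Phi> \<Longrightarrow> \<phi> \<in> bool_combs \<Phi>"
| Top: "Top \<in> bool_combs \<Phi>"
| Neg: "\<phi> \<in> bool_combs \<Phi> \<Longrightarrow> Neg \<phi> \<in> bool_combs \<Phi>"
| Conj: "\<phi> \<in> bool_combs \<Phi> \<Longrightarrow> \<psi> \<in> bool_combs \<Phi> \<Longrightarrow> Conj \<phi> \<psi> \<in> bool_combs \<Phi>"

text \<open>
  In \<open>\<phi>(x, y\<^sub>1, \<dots>, y\<^sub>q)\<close> the variable \<open>x\<close> has index \<open>0\<close> and \<open>y\<^sub>1, \<dots>, y\<^sub>q\<close> have indices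
  \<open>1, \<dots>, q\<close>; \<open>to_block q j\<close> keeps \<open>x\<close> and moves the latter to the \<open>j\<close>-th block (counting
  from \<open>0\<close>) of \<open>q\<close> variables.
\<close>

definition to_block :: "nat \<Rightarrow> nat \<Rightarrow> 'r fm \<Rightarrow> 'r fm" where
  "to_block q j = rename (case_nat 0 (\<lambda>v. Suc (j * q + v)))"

definition Delta :: "nat \<Rightarrow> 'r fm set \<Rightarrow> nat \<Rightarrow> (nat \<times> 'r fm) set" where
  "Delta q \<Phi> k =
     {(i, Ex (Conjs (map (\<lambda>j. to_block q j (\<phi> j)) [0..<i]))) | i \<phi>.
        i \<le> k \<and> (\<forall>j < i. \<phi> j \<in> bool_combs \<Phi>)}"

text \<open>
  The order in which the conjuncts of a type are listed is left open.
\<close>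

definition types :: "'r fm set \<Rightarrow> 'r fm set" where
  "types \<Phi> = {Conj (Conjs \<phi>s) (Conjs (map Neg \<psi>s)) | \<phi>s \<psi>s A.
     A \<subseteq> \<Phi> \<and> set \<phi>s = A \<and> set \<psi>s = \<Phi> - A \<and> distinct \<phi>s \<and> distinct \<psi>s}"

lemma sat_Conjs: "sat M e (Conjs \<phi>s) \<longleftrightarrow> (\<forall>\<phi> \<in> set \<phi>s. sat M e \<phi>)"
  by (induction \<phi>s) (auto simp: Conjs_def)

lemma sat_rename:
  assumes "fm_over \<Sigma> n \<phi>" and "\<And>v. v < n \<Longrightarrow> e' ! f v = e ! v"
  shows "sat M e' (rename f \<phi>) \<longleftrightarrow> sat M e \<phi>"
  using assms
proof (induction \<phi> arbitrary: n e e' f)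
  case (Rel r vs)
  then have "map ((!) e') (map f vs) = map ((!) e) vs"
    by auto
  then show ?case
    by (metis rename.simps(3) sat.simps(3))
next
  case (Ex \<phi>)
  have "sat M (x # e') (rename (case_nat 0 (\<lambda>v. Suc (f v))) \<phi>) \<longleftrightarrow> sat M (x # e) \<phi>" for x
    using Ex.prems by (intro Ex.IH[where n = "Suc n"]) (auto split: nat.split simp: nth_Cons)
  then show ?case
    by simp
next
  case (Conj \<phi> \<psi>)
  then show ?case
    by (metis fm_over.simps(5) rename.simps(5) sat.simps(5))
qed auto

lemma fm_over_bool_combs:
  assumes "\<psi> \<in> bool_combs \<Phi>" and "\<forall>\<phi> \<in> \<Phi>. fm_over \<Sigma> n \<phi>"
  shows "fm_over \<Sigma> n \<psi>"
  using assms by induction auto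

lemma nth_concat_block:
  assumes "\<forall>t \<in> set ts. length t = q" and "j < length ts" and "v < q"
  shows "concat ts ! (j * q + v) = ts ! j ! v"
  using assms
proof (induction ts arbitrary: j)
  case (Cons t ts)
  then show ?case
    by (cases j) (auto simp: nth_append)
qed simp

lemma sat_Delta:
  assumes "\<forall>\<phi> \<in> \<Phi>. fm_over \<Sigma> (Suc q) \<phi>" and "\<forall>j < i. \<phi> j \<in> bool_combs \<Phi>"
    and "length ts = i" and "\<forall>t \<in> set ts. length t = q"
  shows "sat M (concat ts) (Ex (Conjs (map (\<lambda>j. to_block q j (\<phi> j)) [0..<i]))) \<longleftrightarrow>
    (\<exists>x \<in> universe M. \<forall>j < i. sat M (x # ts ! j) (\<phi> j))"
proof -
  have "sat M (x # concat ts) (to_block q j (\<phi> j)) \<longleftrightarrow> sat M (x # ts ! j) (\<phi> j)"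
    if "j < i" for x j
    unfolding to_block_def using that assms
    by (intro sat_rename[where n = "Suc q" and \<Sigma> = \<Sigma>])
      (auto intro: fm_over_bool_combs simp: nth_Cons nth_concat_block split: nat.split)
  then show ?thesis
    by (simp add: sat_Conjs atLeast0LessThan lessThan_def)
qed

end

theory Submission
  imports Defs "HOL-Library.Ramsey"
begin

text \<open>
  Let \<open>\<tau>\<close> be the type that \<open>a\<close> has most often along the sequence, and suppose that \<open>a\<close> fails \<open>\<tau>\<close> at
  two positions. One of the three gaps these positions delimit contains many indices satisfying
  \<open>\<tau>\<close>, so indiscernibility yields, for all \<open>i < j\<close>, an element \<open>c i j\<close> failing \<open>\<tau>\<close> at \<open>i\<close> and \<open>j\<close> and
  satisfying it on the corresponding gap. By Ramsey's theorem for triples one may assume that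
  \<open>c i j\<close> behaves uniformly on each of the three gaps. If it behaves differently on two adjacent
  gaps, then \<open>\<tau>\<close> or its negation has the order property. Otherwise \<open>c i j\<close> satisfies \<open>\<tau>\<close> exactly
  off \<open>{i, j}\<close>, so the \<open>c i j\<close> subdivide a clique on the sequence; marking those \<open>c i j\<close> that belong
  to a half graph by a unary predicate defines an arbitrarily long order.
\<close>

section \<open>Marking a set by a unary predicate\<close>

text \<open>All new symbols except \<open>0\<close> are empty because \<open>structure_over\<close>
  demands this outside the signature, to which \<open>markings\<close> adds the single predicate
  \<open>0\<close>.\<close>

definition marked :: "('a, 'r) struct \<Rightarrow> 'a set \<Rightarrow> ('a, 'r + nat) struct" where
  "marked M P = \<lparr>universe = universe M,
     interp = case_sum (interp M) (\<lambda>u. if u = 0 then (\<lambda>x. [x]) ` P else {})\<rparr>"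

abbreviation markings :: "'r signature \<Rightarrow> ('a, 'r) struct set \<Rightarrow> ('a, 'r + nat) struct set" where
  "markings \<Sigma> C \<equiv> expansions (unary_extension \<Sigma> {0}) C"

lemma universe_marked [simp]: "universe (marked M P) = universe M"
  by (simp add: marked_def)

lemma tuples_marked [simp]: "tuples (marked M P) q = tuples M q"
  by (simp add: tuples_def)

lemma sat_marked [simp]: "sat (marked M P) e (map_fm Inl \<phi>) \<longleftrightarrow> sat M e \<phi>"
  by (induction \<phi> arbitrary: e) (auto simp: marked_def)

lemma marked_in_markings:
  assumes "M \<in> C" and "structure_over \<Sigma> M" and "P \<subseteq> universe M"
  shows "marked M P \<in> markings \<Sigma> C"
proof -
  have "structure_over (unary_extension \<Sigma> {0::nat}) (marked M P)"
    unfolding structure_over_def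
  proof (intro conjI ballI allI impI)
    fix r :: "'b + nat" assume "r \<in> symbols (unary_extension \<Sigma> {0::nat})"
    then show "interp (marked M P) r
        \<subseteq> {t. length t = arity (unary_extension \<Sigma> {0::nat}) r \<and> set t \<subseteq> universe (marked M P)}"
      using assms(2,3) by (cases r) (auto simp: structure_over_def marked_def unary_extension_def)
  next
    fix r :: "'b + nat" assume "r \<notin> symbols (unary_extension \<Sigma> {0::nat})"
    then show "interp (marked M P) r = {}"
      using assms(2) by (cases r) (auto simp: structure_over_def marked_def unary_extension_def)
  qed
  moreover have "reduct (marked M P) = M"
    by (simp add: reduct_def marked_def)
  ultimately show ?thesis
    using assms(1) by (simp add: expansions_def)
qed

lemma fm_over_map_Inl:
  "fm_over (unary_extension \<Sigma> U) n (map_fm Inl \<phi>) \<longleftrightarrow> fm_over \<Sigma> n \<phi>"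
  by (induction \<phi> arbitrary: n) (auto simp: unary_extension_def)

lemma fm_over_rename:
  assumes "fm_over \<Sigma> n \<phi>" and "\<And>v. v < n \<Longrightarrow> f v < m"
  shows "fm_over \<Sigma> m (rename f \<phi>)"
  using assms
proof (induction \<phi> arbitrary: n m f)
  case (Ex \<phi>)
  then show ?case
    by (auto intro!: Ex.IH[where n = "Suc n"] split: nat.split)
qed auto

text \<open>Adjacency in a subdivided graph: the vertices are \<open>q\<close>-tuples, the marked
  elements subdivide the edges, and an element is incident to a tuple when it fails
  \<open>\<theta>\<close> there. Blocks \<open>0\<close> and \<open>1\<close> hold the two
  ends.\<close>

definition link :: "nat \<Rightarrow> 'r fm \<Rightarrow> ('r + nat) fm" where
  "link q \<theta> = Ex (Conj (Rel (Inr 0) [0])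
     (Conj (Neg (to_block q 0 (map_fm Inl \<theta>))) (Neg (to_block q 1 (map_fm Inl \<theta>)))))"

lemma fm_over_link:
  assumes "fm_over \<Sigma> (Suc q) \<theta>"
  shows "fm_over (unary_extension \<Sigma> {0::nat}) (q + q) (link q \<theta>)"
proof -
  have "fm_over (unary_extension \<Sigma> {0::nat}) (Suc (q + q)) (to_block q j (map_fm Inl \<theta>))"
    if "j \<le> 1" for j
  proof -
    have "j = 0 \<or> j = 1"
      using that by auto
    then show ?thesis
      unfolding to_block_def using assms
      by (intro fm_over_rename[where n = "Suc q"]) (auto simp: fm_over_map_Inl split: nat.split)
  qed
  from this[of 0] this[of 1] show ?thesis
    by (auto simp: link_def unary_extension_def)
qed

lemma sat_link:
  assumes "fm_over \<Sigma> (Suc q) \<theta>" and "P \<subseteq> universe M" and "length x = q" and "length y = q"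
  shows "sat (marked M P) (x @ y) (link q \<theta>) \<longleftrightarrow>
    (\<exists>z \<in> P. \<not> sat M (z # x) \<theta> \<and> \<not> sat M (z # y) \<theta>)"
proof -
  have \<theta>: "fm_over (unary_extension \<Sigma> {0::nat}) (Suc q) (map_fm Inl \<theta>)"
    using assms(1) by (simp add: fm_over_map_Inl)
  have "sat (marked M P) (z # x @ y) (to_block q 0 (map_fm Inl \<theta>)) \<longleftrightarrow>
      sat (marked M P) (z # x) (map_fm Inl \<theta>)" for z
    unfolding to_block_def using assms(3)
    by (intro sat_rename[OF \<theta>]) (auto simp: nth_Cons nth_append split: nat.split)
  moreover have "sat (marked M P) (z # x @ y) (to_block q 1 (map_fm Inl \<theta>)) \<longleftrightarrow>
      sat (marked M P) (z # y) (map_fm Inl \<theta>)" for z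
    unfolding to_block_def using assms(3)
    by (intro sat_rename[OF \<theta>]) (auto simp: nth_Cons nth_append split: nat.split)
  moreover have "[z] \<in> interp (marked M P) (Inr 0) \<longleftrightarrow> z \<in> P" for z
    by (auto simp: marked_def)
  ultimately show ?thesis
    using assms(2) by (auto simp: link_def)
qed

section \<open>Order properties\<close>

lemma order_propertyI:
  assumes "M \<in> D" and "\<And>i. i \<in> {1..k} \<Longrightarrow> a i \<in> tuples M p"
    and "\<And>i. i \<in> {1..k} \<Longrightarrow> b i \<in> tuples M q"
    and "\<And>i j. i \<in> {1..k} \<Longrightarrow> j \<in> {1..k} \<Longrightarrow> sat M (a i @ b j) \<psi> \<longleftrightarrow> i \<le> j"
  shows "order_property D p q \<psi> k"
  unfolding order_property_def using assms by blast

lemma order_property_antimono: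
  assumes "order_property D p q \<psi> k" and "k' \<le> k"
  shows "order_property D p q \<psi> k'"
proof -
  obtain M a b where "M \<in> D" and "\<forall>i \<in> {1..k}. a i \<in> tuples M p \<and> b i \<in> tuples M q"
    and "\<forall>i \<in> {1..k}. \<forall>j \<in> {1..k}. sat M (a i @ b j) \<psi> \<longleftrightarrow> i \<le> j"
    using assms(1) unfolding order_property_def by blast
  with assms(2) show ?thesis
    by (intro order_propertyI[of M D k' a p b q]) auto
qed

text \<open>At fixed \<open>i\<close>, the truth value changes from \<open>u\<close> to
  \<open>v\<close> as \<open>l\<close> passes \<open>i\<close>, so the formula compares indices. The
  value \<open>False\<close> on the diagonal decides how: if \<open>u\<close> holds,
  \<open>Neg \<theta>\<close> expresses \<open>i \<le> l\<close>; otherwise \<open>\<theta>\<close>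
  expresses \<open>i < l\<close>.\<close>

lemma order_property_half_graph:
  fixes J :: "nat \<Rightarrow> 'a list"
  assumes M: "M \<in> C" "structure_over \<Sigma> M"
    and J: "\<And>l. l \<le> Suc k \<Longrightarrow> J l \<in> tuples M q"
    and c: "\<And>i. i \<le> Suc k \<Longrightarrow> c i \<in> universe M"
    and sat: "\<And>i l. i \<in> {1..Suc k} \<Longrightarrow> l \<in> {1..Suc k} \<Longrightarrow>
      sat M (c i # J l) \<theta> \<longleftrightarrow> (if l < i then u else if l = i then False else v)"
    and "u \<noteq> v"
  shows "order_property (markings \<Sigma> C) 1 q (map_fm Inl \<theta>) k \<or>
    order_property (markings \<Sigma> C) 1 q (Neg (map_fm Inl \<theta>)) k"
proof -
  \<comment> \<open>The formulas speak about the original signature; the empty marking places the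
    structure in the same class of expansions as the other order property.\<close>
  have mem: "marked M {} \<in> markings \<Sigma> C"
    using M by (intro marked_in_markings) auto
  have c1: "[c i] \<in> tuples (marked M {}) 1" if "i \<le> Suc k" for i
    using c[OF that] by (simp add: tuples_def)
  show ?thesis
  proof (cases u)
    case True
    then have "order_property (markings \<Sigma> C) 1 q (Neg (map_fm Inl \<theta>)) k"
      using c1 J \<open>u \<noteq> v\<close>
      by (intro order_propertyI[OF mem, where a = "\<lambda>i. [c i]" and b = J]) (auto simp: sat)
    then show ?thesis ..
  next
    case False
    \<comment> \<open>Shifting the second tuple by one turns \<open>i < Suc j\<close> into
      \<open>i \<le> j\<close>; this is what the extra index \<open>Suc k\<close> is for.\<close>
    then have "order_property (markings \<Sigma> C) 1 q (map_fm Inl \<theta>) k"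
      using c1 J \<open>u \<noteq> v\<close>
      by (intro order_propertyI[OF mem, where a = "\<lambda>i. [c i]" and b = "\<lambda>i. J (Suc i)"])
        (auto simp: sat)
    then show ?thesis ..
  qed
qed

text \<open>The element \<open>c i j\<close> encodes the pair of its ends as the positions where it
  fails \<open>\<theta>\<close>. Marking a set of such elements therefore makes any chosen bipartite
  graph between the positions \<open>1..k\<close> and \<open>k + 1..2 * k\<close> definable by
  \<open>link\<close>; the half graph is chosen.\<close>

lemma order_property_subdivided_clique:
  fixes J :: "nat \<Rightarrow> 'a list"
  assumes M: "M \<in> C" "structure_over \<Sigma> M" and \<theta>: "fm_over \<Sigma> (Suc q) \<theta>"
    and J: "\<And>l. l \<le> 2 * k \<Longrightarrow> J l \<in> tuples M q"
    and c: "\<And>i j. i < j \<Longrightarrow> j \<le> 2 * k \<Longrightarrow> c i j \<in> universe M"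
    and sat: "\<And>i j l. i < j \<Longrightarrow> j \<le> 2 * k \<Longrightarrow> l \<le> 2 * k \<Longrightarrow>
      sat M (c i j # J l) \<theta> \<longleftrightarrow> l \<noteq> i \<and> l \<noteq> j"
  shows "order_property (markings \<Sigma> C) q q (link q \<theta>) k"
proof -
  define P where "P = {c i (k + j) | i j. 1 \<le> i \<and> i \<le> j \<and> j \<le> k}"
  have P: "P \<subseteq> universe M"
    unfolding P_def by (auto intro!: c)
  have mem: "marked M P \<in> markings \<Sigma> C"
    using M P by (intro marked_in_markings)
  have "sat (marked M P) (J i @ J (k + j)) (link q \<theta>) \<longleftrightarrow> i \<le> j"
    if "i \<in> {1..k}" "j \<in> {1..k}" for i j
  proof -
    have "length (J i) = q" "length (J (k + j)) = q"
      using J[of i] J[of "k + j"] that by (auto simp: tuples_def)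
    then have "sat (marked M P) (J i @ J (k + j)) (link q \<theta>) \<longleftrightarrow>
        (\<exists>z \<in> P. \<not> sat M (z # J i) \<theta> \<and> \<not> sat M (z # J (k + j)) \<theta>)"
      by (rule sat_link[OF \<theta> P])
    also have "\<dots> \<longleftrightarrow> i \<le> j"
    proof
      \<comment> \<open>The marked element fails only at \<open>i'\<close> and
        \<open>k + j'\<close>. As \<open>i\<close> and \<open>i'\<close> are at most
        \<open>k\<close>, while \<open>k + j\<close> and \<open>k + j'\<close> exceed it,
        \<open>i = i'\<close> and \<open>j = j'\<close>.\<close>
      assume "\<exists>z \<in> P. \<not> sat M (z # J i) \<theta> \<and> \<not> sat M (z # J (k + j)) \<theta>"
      then obtain i' j' where ij: "1 \<le> i'" "i' \<le> j'" "j' \<le> k"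
        and "\<not> sat M (c i' (k + j') # J i) \<theta>" "\<not> sat M (c i' (k + j') # J (k + j)) \<theta>"
        unfolding P_def by blast
      then show "i \<le> j"
        using that by (auto simp: sat)
    next
      assume "i \<le> j"
      then have "c i (k + j) \<in> P"
        unfolding P_def using that by auto
      then show "\<exists>z \<in> P. \<not> sat M (z # J i) \<theta> \<and> \<not> sat M (z # J (k + j)) \<theta>"
        using that by (intro bexI[of _ "c i (k + j)"]) (auto simp: sat)
    qed
    finally show ?thesis .
  qed
  then show ?thesis
    using J by (intro order_propertyI[OF mem, where a = J and b = "\<lambda>j. J (k + j)"]) auto
qed

section \<open>Homogeneous triples\<close>

text \<open>A third point can lie left of, between or right of a pair. Colouring a triple by the
  truth values of \<open>E\<close> in these three roles uses eight colours, and one homogeneous set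
  fixes all three values at once.\<close>

lemma ramsey_triples:
  fixes s :: nat
  shows "\<exists>N. \<forall>E :: nat \<Rightarrow> nat \<Rightarrow> nat \<Rightarrow> bool. \<exists>h u v w.
    strict_mono_on {..<s} h \<and> h ` {..<s} \<subseteq> {..<N} \<and>
    (\<forall>x y z. x < y \<and> y < z \<and> z < s \<longrightarrow>
       E (h y) (h z) (h x) = u \<and> E (h x) (h z) (h y) = v \<and> E (h x) (h y) (h z) = w)"
proof -
  obtain N :: nat where N: "partn_lst {..<N} (replicate 8 s) 3"
    using ramsey_full by blast
  show ?thesis
  proof (intro exI[of _ N] allI)
    fix E :: "nat \<Rightarrow> nat \<Rightarrow> nat \<Rightarrow> bool"
    define col where "col x y z = (of_bool (E y z x) + 2 * of_bool (E x z y) + 4 * of_bool (E x y z) :: nat)"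
      for x y z
    \<comment> \<open>Ramsey's theorem colours unordered sets; sorting recovers the roles of the
      three points.\<close>
    define f where "f X = (let xs = sorted_list_of_set X in col (xs ! 0) (xs ! 1) (xs ! 2))" for X
    have f: "f {x, y, z} = col x y z" if "x < y" "y < z" for x y z
    proof -
      have "sorted_list_of_set {x, y, z} = [x, y, z]"
        using that by (simp add: insort_key.simps)
      then show ?thesis
        by (simp add: f_def)
    qed
    have "f \<in> nsets {..<N} 3 \<rightarrow> {..<length (replicate 8 s)}"
      by (auto simp: f_def col_def Let_def)
    with N obtain i where "i < 8" and "monochromatic {..<N} s 3 f i"
      unfolding partn_lst_def by (metis length_replicate nth_replicate)
    then obtain H where H: "H \<subseteq> {..<N}" "finite H" "card H = s" and mono: "f ` nsets H 3 \<subseteq> {i}"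
      by (auto simp: monochromatic_def nsets_def)
    obtain h where h: "bij_betw h {..<s} H" "strict_mono_on {..<s} h"
      using ex_bij_betw_strict_mono_card[OF H(2)] H(3) by metis
    have colour: "col (h x) (h y) (h z) = i" if "x < y" "y < z" "z < s" for x y z
    proof -
      have lt: "h x < h y" "h y < h z"
        using h(2) that by (auto simp: strict_mono_on_def)
      have "h x \<in> H" "h y \<in> H" "h z \<in> H"
        using h(1) that by (auto simp: bij_betw_def)
      then have "{h x, h y, h z} \<in> nsets H 3"
        using lt unfolding ordered_nsets_3_eq by blast
      with mono f[OF lt] show ?thesis
        by auto
    qed
    have inj: "a = a' \<and> b = b' \<and> d = d'"
      if "of_bool a + 2 * of_bool b + 4 * of_bool d = (of_bool a' + 2 * of_bool b' + 4 * of_bool d' :: nat)"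
      for a b d a' b' d' :: bool
      using that by (cases a; cases b; cases d; cases a'; cases b'; cases d') simp_all
    \<comment> \<open>The triple \<open>0, 1, 2\<close> supplies the common values. If
      \<open>s < 3\<close>, it may leave the range, but then there is no triple to compare
      with.\<close>
    have eq: "E (h y) (h z) (h x) = E (h 1) (h 2) (h 0) \<and> E (h x) (h z) (h y) = E (h 0) (h 2) (h 1) \<and>
        E (h x) (h y) (h z) = E (h 0) (h 1) (h 2)" if "x < y" "y < z" "z < s" for x y z
    proof -
      have "col (h x) (h y) (h z) = col (h 0) (h 1) (h 2)"
        using colour[OF that] colour[of 0 1 2] that by simp
      then show ?thesis
        unfolding col_def by (rule inj)
    qed
    have "h ` {..<s} \<subseteq> {..<N}"
      using h(1) H(1) by (auto simp: bij_betw_def)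
    with h(2) eq show "\<exists>h u v w. strict_mono_on {..<s} h \<and> h ` {..<s} \<subseteq> {..<N} \<and>
      (\<forall>x y z. x < y \<and> y < z \<and> z < s \<longrightarrow>
         E (h y) (h z) (h x) = u \<and> E (h x) (h z) (h y) = v \<and> E (h x) (h y) (h z) = w)"
      by blast
  qed
qed

text \<open>\<open>E i j l\<close> is read as: the element chosen for the pair \<open>i < j\<close>
  satisfies the formula at position \<open>l\<close>. The gap on which it must do so is the same for
  all pairs; the other two gaps are unconstrained until Ramsey's theorem makes them uniform.\<close>

definition two_exceptions :: "(nat \<Rightarrow> nat \<Rightarrow> nat \<Rightarrow> bool) \<Rightarrow> nat \<Rightarrow> bool" where
  "two_exceptions E N \<longleftrightarrow>
     (\<forall>i j. i < j \<and> j < N \<longrightarrow> \<not> E i j i \<and> \<not> E i j j) \<and>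
     ((\<forall>i j l. l < i \<and> i < j \<and> j < N \<longrightarrow> E i j l) \<or>
      (\<forall>i j l. i < l \<and> l < j \<and> j < N \<longrightarrow> E i j l) \<or>
      (\<forall>i j l. i < j \<and> j < l \<and> l < N \<longrightarrow> E i j l))"

text \<open>On a homogeneous subsequence three truth values describe all \<open>c i j\<close>. A
  change of value at the left or at the right end gives a half graph; no change leaves a subdivided
  clique. The bound \<open>N\<close> precedes the structure and so serves all of
  \<open>C\<close>.\<close>

lemma order_property_two_exceptions:
  fixes C :: "('a, 'r) struct set"
  assumes \<theta>: "fm_over \<Sigma> (Suc q) \<theta>"
  shows "\<exists>N. \<forall>M \<in> C. \<forall>J c. structure_over \<Sigma> M \<and> (\<forall>l < N. J l \<in> tuples M q) \<and>
    (\<forall>i j. i < j \<and> j < N \<longrightarrow> c i j \<in> universe M) \<and>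
    two_exceptions (\<lambda>i j l. sat M (c i j # J l) \<theta>) N \<longrightarrow>
    order_property (markings \<Sigma> C) 1 q (map_fm Inl \<theta>) k \<or>
    order_property (markings \<Sigma> C) 1 q (Neg (map_fm Inl \<theta>)) k \<or>
    order_property (markings \<Sigma> C) q q (link q \<theta>) k"
proof -
  \<comment> \<open>Positions up to \<open>k + 2\<close> are used for the half graphs and up to
    \<open>2 * k\<close> for the clique; the triple \<open>0, 1, 2\<close> must exist as
    well.\<close>
  define s where "s = 2 * k + 3"
  obtain N where N: "\<And>E :: nat \<Rightarrow> nat \<Rightarrow> nat \<Rightarrow> bool. \<exists>h u v w.
    strict_mono_on {..<s} h \<and> h ` {..<s} \<subseteq> {..<N} \<and>
    (\<forall>x y z. x < y \<and> y < z \<and> z < s \<longrightarrow>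
       E (h y) (h z) (h x) = u \<and> E (h x) (h z) (h y) = v \<and> E (h x) (h y) (h z) = w)"
    using ramsey_triples[of s] by blast
  show ?thesis
  proof (intro exI[of _ N] ballI allI impI, elim conjE)
    fix M and J :: "nat \<Rightarrow> 'a list" and c :: "nat \<Rightarrow> nat \<Rightarrow> 'a"
    assume M: "M \<in> C" "structure_over \<Sigma> M"
      and J: "\<forall>l < N. J l \<in> tuples M q"
      and c_univ: "\<forall>i j. i < j \<and> j < N \<longrightarrow> c i j \<in> universe M"
      and two: "two_exceptions (\<lambda>i j l. sat M (c i j # J l) \<theta>) N"
    from two have c: "\<forall>i j. i < j \<and> j < N \<longrightarrow>
        \<not> sat M (c i j # J i) \<theta> \<and> \<not> sat M (c i j # J j) \<theta>"
      and gap: "(\<forall>i j l. l < i \<and> i < j \<and> j < N \<longrightarrow> sat M (c i j # J l) \<theta>) \<or>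
        (\<forall>i j l. i < l \<and> l < j \<and> j < N \<longrightarrow> sat M (c i j # J l) \<theta>) \<or>
        (\<forall>i j l. i < j \<and> j < l \<and> l < N \<longrightarrow> sat M (c i j # J l) \<theta>)"
      unfolding two_exceptions_def by blast+
    obtain h u v w where mono: "strict_mono_on {..<s} h" and ran: "h ` {..<s} \<subseteq> {..<N}"
      and "\<forall>x y z. x < y \<and> y < z \<and> z < s \<longrightarrow>
        sat M (c (h y) (h z) # J (h x)) \<theta> = u \<and> sat M (c (h x) (h z) # J (h y)) \<theta> = v \<and>
        sat M (c (h x) (h y) # J (h z)) \<theta> = w"
      using N[of "\<lambda>i j l. sat M (c i j # J l) \<theta>"] by (elim exE conjE) (rule that)
    note hom = this(3)[rule_format, OF conjI, OF _ conjI]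
    have hN: "h x < N" if "x < s" for x
      using ran that by auto
    have h_less: "h x < h y" if "x < y" "y < s" for x y
      using mono that by (auto simp: strict_mono_on_def)
    have Jh: "J (h x) \<in> tuples M q" if "x < s" for x
      using J hN that by blast
    have ch: "c (h x) (h y) \<in> universe M" "\<not> sat M (c (h x) (h y) # J (h x)) \<theta>"
      "\<not> sat M (c (h x) (h y) # J (h y)) \<theta>" if "x < y" "y < s" for x y
      using c_univ c h_less hN that by blast+
    have "0 < s" "1 < s" "2 < s"
      by (auto simp: s_def)
    \<comment> \<open>The distinguished gap shows in the triple \<open>0, 1, 2\<close>, which rules
      out elements that fail on all three gaps.\<close>
    then have "u \<or> v \<or> w"
      using gap hom[of 0 1 2] h_less[of 0 1] h_less[of 1 2] hN[of 2] by auto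
    then consider "u \<noteq> v" | "v \<noteq> w" | "u" "v" "w"
      by blast
    then show "order_property (markings \<Sigma> C) 1 q (map_fm Inl \<theta>) k \<or>
      order_property (markings \<Sigma> C) 1 q (Neg (map_fm Inl \<theta>)) k \<or>
      order_property (markings \<Sigma> C) q q (link q \<theta>) k"
    proof cases
      case 1
      \<comment> \<open>The right end is fixed beyond all tested positions and the left end varies,
        which exposes the change from \<open>u\<close> to \<open>v\<close>.\<close>
      have "sat M (c (h i) (h (k + 2)) # J (h l)) \<theta> \<longleftrightarrow>
          (if l < i then u else if l = i then False else v)"
        if "i \<in> {1..Suc k}" "l \<in> {1..Suc k}" for i l
        using that hom[of l i "k + 2"] hom[of i l "k + 2"] ch[of i "k + 2"]
        by (auto simp: s_def)
      then show ?thesis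
        using order_property_half_graph[OF M, of k "\<lambda>l. J (h l)" q "\<lambda>i. c (h i) (h (k + 2))" \<theta> u v]
          Jh ch(1) 1 by (auto simp: s_def)
    next
      case 2
      \<comment> \<open>Dually, the left end is fixed at \<open>0\<close> and the right end varies;
        \<open>Suc\<close> keeps the tested positions right of \<open>0\<close>.\<close>
      have "sat M (c (h 0) (h (Suc j)) # J (h (Suc l))) \<theta> \<longleftrightarrow>
          (if l < j then v else if l = j then False else w)"
        if "j \<in> {1..Suc k}" "l \<in> {1..Suc k}" for j l
        using that hom[of 0 "Suc l" "Suc j"] hom[of 0 "Suc j" "Suc l"] ch[of 0 "Suc j"]
        by (auto simp: s_def)
      then show ?thesis
        using order_property_half_graph[OF M, of k "\<lambda>l. J (h (Suc l))" q
            "\<lambda>j. c (h 0) (h (Suc j))" \<theta> v w] Jh ch(1) 2 by (auto simp: s_def)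
    next
      case 3
      have "sat M (c (h i) (h j) # J (h l)) \<theta> \<longleftrightarrow> l \<noteq> i \<and> l \<noteq> j"
        if "i < j" "j \<le> 2 * k" "l \<le> 2 * k" for i j l
      proof -
        consider "l < i" | "l = i" | "i < l" "l < j" | "l = j" | "j < l"
          by linarith
        then show ?thesis
          using that 3 hom[of l i j] hom[of i l j] hom[of i j l] ch[of i j]
          by cases (auto simp: s_def)
      qed
      then show ?thesis
        using order_property_subdivided_clique[OF M \<theta>, of k "\<lambda>l. J (h l)"
            "\<lambda>i j. c (h i) (h j)"] Jh ch(1) by (auto simp: s_def)
    qed
  qed
qed

section \<open>Moving patterns along an indiscernible sequence\<close>

lemma indiscernible_pattern:
  assumes \<Phi>: "\<forall>\<phi> \<in> \<Phi>. fm_over \<Sigma> (Suc q) \<phi>" and \<theta>: "\<theta> \<in> bool_combs \<Phi>"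
    and I: "\<forall>i \<in> {1..n}. I i \<in> tuples M q"
    and ind: "\<forall>\<gamma> \<in> Delta q \<Phi> k. indiscernible M n I \<gamma>"
    and a: "a \<in> universe M"
    and S: "S \<subseteq> {1..n}" "card S \<le> k" and f: "strict_mono_on S f" "f ` S \<subseteq> {1..n}"
  shows "\<exists>c \<in> universe M. \<forall>l \<in> S. sat M (c # I l) \<theta> \<longleftrightarrow> sat M (a # I (f l)) \<theta>"
proof -
  define js where "js = sorted_list_of_set S"
  define "is" where "is = map f js"
  define m where "m = card S"
  define \<phi> where "\<phi> j = (if sat M (a # I (is ! j)) \<theta> then \<theta> else Neg \<theta>)" for j
  have fin: "finite S"
    using S(1) finite_subset by blast
  have js: "sorted_wrt (<) js" "set js = S" "length js = m"
    using fin by (auto simp: js_def m_def)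
  have "is": "sorted_wrt (<) is" "set is \<subseteq> {1..n}" "length is = m"
    using js f unfolding is_def
    by (auto simp: sorted_wrt_map strict_mono_on_def intro!: sorted_wrt_mono_rel[OF _ js(1)])
  have \<phi>: "\<forall>j < m. \<phi> j \<in> bool_combs \<Phi>"
    using \<theta> by (auto simp: \<phi>_def intro: bool_combs.Neg)
  let ?\<gamma> = "Ex (Conjs (map (\<lambda>j. to_block q j (\<phi> j)) [0..<m]))"
  have "(m, ?\<gamma>) \<in> Delta q \<Phi> k"
    using \<phi> S(2) unfolding Delta_def m_def by blast
  with ind have "indiscernible M n I (m, ?\<gamma>)"
    by blast
  note this[unfolded indiscernible_def prod.case, rule_format, of "is" js]
  then have iff: "sat M (concat (map I is)) ?\<gamma> \<longleftrightarrow> sat M (concat (map I js)) ?\<gamma>"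
    using "is" js S(1) by blast
  have sat: "sat M (concat (map I ks)) ?\<gamma> \<longleftrightarrow>
      (\<exists>x \<in> universe M. \<forall>j < m. sat M (x # I (ks ! j)) (\<phi> j))"
    if "length ks = m" "set ks \<subseteq> {1..n}" for ks
  proof -
    have "\<forall>t \<in> set (map I ks). length t = q"
      using I that(2) by (auto simp: tuples_def)
    then show ?thesis
      using sat_Delta[OF \<Phi> \<phi>, of "map I ks" M] that(1) by simp
  qed
  have "sat M (concat (map I is)) ?\<gamma>"
    unfolding sat[OF "is"(3,2)] using a by (intro bexI[of _ a]) (auto simp: \<phi>_def)
  then have "sat M (concat (map I js)) ?\<gamma>"
    using iff by blast
  then obtain c where c: "c \<in> universe M" "\<forall>j < m. sat M (c # I (js ! j)) (\<phi> j)"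
    using sat[of js] js S(1) by auto
  have "sat M (c # I l) \<theta> \<longleftrightarrow> sat M (a # I (f l)) \<theta>" if l: "l \<in> S" for l
  proof -
    obtain j where "j < m" "l = js ! j"
      using l js(2,3) by (metis in_set_conv_nth)
    then show ?thesis
      using c(2) js(3) by (auto simp: \<phi>_def is_def split: if_splits)
  qed
  with c(1) show ?thesis
    by blast
qed

section \<open>Copying two exceptions of one element to all pairs of positions\<close>

lemma ex_strict_mono_on_into:
  fixes X :: "nat set"
  assumes "N \<le> card X"
  shows "\<exists>e. strict_mono_on {..<N} e \<and> e ` {..<N} \<subseteq> X"
proof -
  obtain T where T: "T \<subseteq> X" "card T = N" "finite T"
    using obtain_subset_with_card_n[OF assms] .
  obtain e where "bij_betw e {..<N} T" "strict_mono_on {..<N} e"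
    using ex_bij_betw_strict_mono_card[OF T(3)] T(2) by metis
  with T(1) show ?thesis
    by (auto simp: bij_betw_def)
qed

text \<open>The exceptions \<open>p\<^sub>1\<close> and \<open>p\<^sub>2\<close> are pulled back to
  an arbitrary pair \<open>i < j\<close>, together with positions from a gap in which
  \<open>a\<close> satisfies \<open>\<theta>\<close> often. The shift by \<open>Suc\<close>
  reconciles positions from \<open>0\<close> with a sequence indexed from \<open>1\<close>.\<close>

lemma indiscernible_two_exceptions:
  assumes \<Phi>: "\<forall>\<phi> \<in> \<Phi>. fm_over \<Sigma> (Suc q) \<phi>" and \<theta>: "\<theta> \<in> bool_combs \<Phi>"
    and I: "\<forall>i \<in> {1..n}. I i \<in> tuples M q"
    and ind: "\<forall>\<gamma> \<in> Delta q \<Phi> N. indiscernible M n I \<gamma>"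
    and a: "a \<in> universe M" and "N \<le> n"
    and p: "p\<^sub>1 \<in> {1..n}" "p\<^sub>2 \<in> {1..n}" "p\<^sub>1 < p\<^sub>2"
      "\<not> sat M (a # I p\<^sub>1) \<theta>" "\<not> sat M (a # I p\<^sub>2) \<theta>"
    and many: "3 * N \<le> card {l \<in> {1..n}. sat M (a # I l) \<theta>}"
  shows "\<exists>c. (\<forall>i j. i < j \<and> j < N \<longrightarrow> c i j \<in> universe M) \<and>
    two_exceptions (\<lambda>i j l. sat M (c i j # I (Suc l)) \<theta>) N"
proof -
  define X where "X = {l \<in> {1..n}. sat M (a # I l) \<theta>}"
  \<comment> \<open>The three gaps are treated at once: \<open>R i j\<close> is the gap relative to
    \<open>i, j\<close>, and \<open>Y\<close> is a supply of good positions in the same gap relative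
    to \<open>p\<^sub>1, p\<^sub>2\<close>, as \<open>left\<close> expresses.\<close>
  have realise: "\<exists>c. \<forall>i j. i < j \<and> j < N \<longrightarrow> c i j \<in> universe M \<and>
      \<not> sat M (c i j # I (Suc i)) \<theta> \<and> \<not> sat M (c i j # I (Suc j)) \<theta> \<and>
      (\<forall>l \<in> R i j. sat M (c i j # I (Suc l)) \<theta>)"
    if R: "\<And>i j. i < j \<Longrightarrow> j < N \<Longrightarrow> R i j \<subseteq> {..<N} - {i, j}"
      and Y: "Y \<subseteq> X" "N \<le> card Y"
      and left: "\<And>i j l y. l \<in> R i j \<Longrightarrow> y \<in> Y \<Longrightarrow> (l < i \<longleftrightarrow> y < p\<^sub>1) \<and> (l < j \<longleftrightarrow> y < p\<^sub>2)"
    for R :: "nat \<Rightarrow> nat \<Rightarrow> nat set" and Y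
  proof -
    obtain e where e: "strict_mono_on {..<N} e" "e ` {..<N} \<subseteq> Y"
      using ex_strict_mono_on_into[OF Y(2)] by blast
    have "\<exists>c. c \<in> universe M \<and>
      \<not> sat M (c # I (Suc i)) \<theta> \<and> \<not> sat M (c # I (Suc j)) \<theta> \<and>
      (\<forall>l \<in> R i j. sat M (c # I (Suc l)) \<theta>)" if ij: "i < j" "j < N" for i j
    proof -
      define S where "S = Suc ` (insert i (insert j (R i j)))"
      \<comment> \<open>Since \<open>Y\<close> lies on the correct side of both exceptions, sending
        the ends to the exceptions and the gap into \<open>Y\<close> by \<open>e\<close> preserves
        the order.\<close>
      define f where "f l = (if l = Suc i then p\<^sub>1 else if l = Suc j then p\<^sub>2 else e (l - 1))" for l
      have Rij: "R i j \<subseteq> {..<N} - {i, j}"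
        using R ij by blast
      have S1: "S \<subseteq> Suc ` {..<N}"
        using Rij ij unfolding S_def by auto
      then have S2: "S \<subseteq> {1..n}"
        using \<open>N \<le> n\<close> by auto
      have "card S \<le> card (Suc ` {..<N})"
        using S1 by (intro card_mono) auto
      then have S3: "card S \<le> N"
        by (simp add: card_image)
      have eR: "e l \<in> Y" "e l \<in> X" "e l \<noteq> p\<^sub>1" "e l \<noteq> p\<^sub>2" "l \<noteq> i" "l \<noteq> j" "e l < p\<^sub>1 \<longleftrightarrow> l < i"
        "e l < p\<^sub>2 \<longleftrightarrow> l < j" if "l \<in> R i j" for l
      proof -
        show "e l \<in> Y" "e l \<in> X"
          using that Rij e(2) Y(1) by auto
        then show "e l \<noteq> p\<^sub>1" "e l \<noteq> p\<^sub>2"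
          using p by (auto simp: X_def)
        show "l \<noteq> i" "l \<noteq> j"
          using that Rij by auto
        show "e l < p\<^sub>1 \<longleftrightarrow> l < i" "e l < p\<^sub>2 \<longleftrightarrow> l < j"
          using left[OF that \<open>e l \<in> Y\<close>] by auto
      qed
      have f_eq: "f (Suc i) = p\<^sub>1" "f (Suc j) = p\<^sub>2" "\<And>l. l \<in> R i j \<Longrightarrow> f (Suc l) = e l"
        using ij eR by (auto simp: f_def)
      have e_less: "e l < e l'" if "l \<in> R i j" "l' \<in> R i j" "l < l'" for l l'
        using e(1) Rij that unfolding strict_mono_on_def by blast
      have f1: "strict_mono_on S f"
      proof (rule strict_mono_onI)
        fix r r' assume "r \<in> S" "r' \<in> S" "r < r'"
        then obtain l l' where l: "r = Suc l" "r' = Suc l'" "l < l'"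
            "l \<in> insert i (insert j (R i j))" "l' \<in> insert i (insert j (R i j))"
          unfolding S_def by auto
        consider "l \<in> R i j" "l' \<in> R i j" | "l \<in> R i j" "l' = i" | "l \<in> R i j" "l' = j"
          | "l = i" "l' \<in> R i j" | "l = j" "l' \<in> R i j" | "l = i" "l' = j"
          using l ij by auto
        then show "f r < f r'"
        proof cases
          case 1
          then show ?thesis using l e_less f_eq by auto
        next
          case 2
          then show ?thesis using l eR[of l] f_eq by auto
        next
          case 3
          then show ?thesis using l eR[of l] f_eq by auto
        next
          case 4
          then show ?thesis using l eR[of l'] f_eq by auto
        next
          case 5
          then show ?thesis using l eR[of l'] f_eq by auto
        next
          case 6
          then show ?thesis using l p f_eq by auto
        qed
      qed
      have f2: "f ` S \<subseteq> {1..n}"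
        using p eR(2) f_eq unfolding S_def X_def by auto
      obtain c where c: "c \<in> universe M"
          "\<forall>l \<in> S. sat M (c # I l) \<theta> \<longleftrightarrow> sat M (a # I (f l)) \<theta>"
        using indiscernible_pattern[OF \<Phi> \<theta> I ind a S2 S3 f1 f2] by blast
      then have "\<not> sat M (c # I (Suc i)) \<theta>" "\<not> sat M (c # I (Suc j)) \<theta>"
        using p f_eq by (auto simp: S_def)
      moreover have "sat M (c # I (Suc l)) \<theta>" if "l \<in> R i j" for l
        using c(2) f_eq(3)[OF that] eR(2)[OF that] that by (auto simp: S_def X_def)
      ultimately show ?thesis
        using c(1) by blast
    qed
    then show ?thesis
      by metis
  qed
  \<comment> \<open>The good positions avoid both exceptions, so the gaps share at least
    \<open>3 * N\<close> of them and one gap receives \<open>N\<close>.\<close>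
  let ?A = "{l \<in> X. l < p\<^sub>1}" and ?B = "{l \<in> X. p\<^sub>1 < l \<and> l < p\<^sub>2}" and ?C = "{l \<in> X. p\<^sub>2 < l}"
  have "X = ?A \<union> ?B \<union> ?C"
  proof -
    have "p\<^sub>1 \<notin> X" "p\<^sub>2 \<notin> X"
      using p by (auto simp: X_def)
    then have "l < p\<^sub>1 \<or> p\<^sub>1 < l \<and> l < p\<^sub>2 \<or> p\<^sub>2 < l" if "l \<in> X" for l
      using that by (metis nat_neq_iff)
    then show ?thesis
      by blast
  qed
  then have "card X \<le> card ?A + card ?B + card ?C"
    using card_Un_le[of "?A \<union> ?B" ?C] card_Un_le[of ?A ?B] by simp
  with many have "N \<le> card ?A \<or> N \<le> card ?B \<or> N \<le> card ?C"
    unfolding X_def[symmetric] by linarith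
  then show ?thesis
  proof (elim disjE)
    assume "N \<le> card ?A"
    \<comment> \<open>The conjunct \<open>i < j\<close> inside the gap makes \<open>left\<close>
      true for all \<open>i, j\<close>, since it is required there without any order between
      them.\<close>
    then have "\<exists>c. \<forall>i j. i < j \<and> j < N \<longrightarrow> c i j \<in> universe M \<and>
      \<not> sat M (c i j # I (Suc i)) \<theta> \<and> \<not> sat M (c i j # I (Suc j)) \<theta> \<and>
      (\<forall>l \<in> {l. l < i \<and> i < j}. sat M (c i j # I (Suc l)) \<theta>)"
      using p(3) by (intro realise[of _ ?A]) auto
    then obtain c where "\<forall>i j. i < j \<and> j < N \<longrightarrow> c i j \<in> universe M \<and>
      \<not> sat M (c i j # I (Suc i)) \<theta> \<and> \<not> sat M (c i j # I (Suc j)) \<theta> \<and>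
      (\<forall>l \<in> {l. l < i \<and> i < j}. sat M (c i j # I (Suc l)) \<theta>)"
      by blast
    then show ?thesis
      unfolding two_exceptions_def by (intro exI[of _ c]) auto
  next
    assume "N \<le> card ?B"
    then have "\<exists>c. \<forall>i j. i < j \<and> j < N \<longrightarrow> c i j \<in> universe M \<and>
      \<not> sat M (c i j # I (Suc i)) \<theta> \<and> \<not> sat M (c i j # I (Suc j)) \<theta> \<and>
      (\<forall>l \<in> {i<..<j}. sat M (c i j # I (Suc l)) \<theta>)"
      using p(3) by (intro realise[of _ ?B]) auto
    then obtain c where "\<forall>i j. i < j \<and> j < N \<longrightarrow> c i j \<in> universe M \<and>
      \<not> sat M (c i j # I (Suc i)) \<theta> \<and> \<not> sat M (c i j # I (Suc j)) \<theta> \<and>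
      (\<forall>l \<in> {i<..<j}. sat M (c i j # I (Suc l)) \<theta>)"
      by blast
    then show ?thesis
      unfolding two_exceptions_def by (intro exI[of _ c]) auto
  next
    assume "N \<le> card ?C"
    then have "\<exists>c. \<forall>i j. i < j \<and> j < N \<longrightarrow> c i j \<in> universe M \<and>
      \<not> sat M (c i j # I (Suc i)) \<theta> \<and> \<not> sat M (c i j # I (Suc j)) \<theta> \<and>
      (\<forall>l \<in> {l. i < j \<and> j < l \<and> l < N}. sat M (c i j # I (Suc l)) \<theta>)"
      using p(3) by (intro realise[of _ ?C]) auto
    then obtain c where "\<forall>i j. i < j \<and> j < N \<longrightarrow> c i j \<in> universe M \<and>
      \<not> sat M (c i j # I (Suc i)) \<theta> \<and> \<not> sat M (c i j # I (Suc j)) \<theta> \<and>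
      (\<forall>l \<in> {l. i < j \<and> j < l \<and> l < N}. sat M (c i j # I (Suc l)) \<theta>)"
      by blast
    then show ?thesis
      unfolding two_exceptions_def by (intro exI[of _ c]) auto
  qed
qed

section \<open>Types\<close>

lemma Conjs_in_bool_combs: "set \<phi>s \<subseteq> bool_combs \<Phi> \<Longrightarrow> Conjs \<phi>s \<in> bool_combs \<Phi>"
  by (induction \<phi>s) (auto simp: Conjs_def intro: bool_combs.intros)

lemma types_subset_bool_combs: "types \<Phi> \<subseteq> bool_combs \<Phi>"
  by (auto simp: types_def intro!: bool_combs.Conj Conjs_in_bool_combs bool_combs.Neg
      intro: bool_combs.base)

text \<open>The point is uniformity: one \<open>\<tau>\<close> for each \<open>A\<close>,
  independent of structure and tuple, so that bounds can be chosen for each \<open>A\<close> in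
  advance. Any listing of \<open>A\<close> and of its complement will do.\<close>

lemma ex_type:
  assumes "finite \<Phi>" and "A \<subseteq> \<Phi>"
  shows "\<exists>\<tau>. \<tau> \<in> types \<Phi> \<and>
    (\<forall>(M :: ('a, 'r) struct) e. {\<phi> \<in> \<Phi>. sat M e \<phi>} = A \<longrightarrow> sat M e \<tau>)"
proof -
  obtain \<phi>s where \<phi>s: "set \<phi>s = A" "distinct \<phi>s"
    using finite_distinct_list[of A] assms finite_subset by blast
  obtain \<psi>s where \<psi>s: "set \<psi>s = \<Phi> - A" "distinct \<psi>s"
    using finite_distinct_list[of "\<Phi> - A"] assms by blast
  have "Conj (Conjs \<phi>s) (Conjs (map Neg \<psi>s)) \<in> types \<Phi>"
    unfolding types_def using assms(2) \<phi>s \<psi>s by blast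
  moreover have "sat M e (Conj (Conjs \<phi>s) (Conjs (map Neg \<psi>s)))"
    if "{\<phi> \<in> \<Phi>. sat M e \<phi>} = A" for M :: "('a, 'r) struct" and e
    using that \<phi>s \<psi>s by (auto simp: sat_Conjs)
  ultimately show ?thesis
    by blast
qed

section \<open>Bounds from stability and the final pigeonhole argument\<close>

lemma monadically_stable_bound:
  assumes "monadically_stable \<Sigma> C" and "fm_over \<Sigma> (Suc q) \<theta>"
  shows "\<exists>k. \<not> order_property (markings \<Sigma> C) 1 q (map_fm Inl \<theta>) k \<and>
    \<not> order_property (markings \<Sigma> C) 1 q (Neg (map_fm Inl \<theta>)) k \<and>
    \<not> order_property (markings \<Sigma> C) q q (link q \<theta>) k"
proof -
  let ?D = "markings \<Sigma> C"
  have "stable (unary_extension \<Sigma> {0::nat}) ?D"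
    using assms(1) unfolding monadically_stable_def by blast
  then have st: "\<exists>k. \<not> order_property ?D p r \<psi> k"
    if "fm_over (unary_extension \<Sigma> {0::nat}) (p + r) \<psi>" for p r \<psi>
    using that unfolding stable_def by blast
  have \<theta>: "fm_over (unary_extension \<Sigma> {0::nat}) (1 + q) (map_fm Inl \<theta>)"
    using assms(2) by (simp add: fm_over_map_Inl)
  obtain k\<^sub>1 where k1: "\<not> order_property ?D 1 q (map_fm Inl \<theta>) k\<^sub>1"
    using st[OF \<theta>] by blast
  obtain k\<^sub>2 where k2: "\<not> order_property ?D 1 q (Neg (map_fm Inl \<theta>)) k\<^sub>2"
    using st[of 1 q "Neg (map_fm Inl \<theta>)"] \<theta> by auto
  obtain k\<^sub>3 where k3: "\<not> order_property ?D q q (link q \<theta>) k\<^sub>3"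
    using st[OF fm_over_link[OF assms(2)]] by blast
  show ?thesis
  \<comment> \<open>A long order contains all shorter ones, so the sum of the three bounds works for
    each formula.\<close>
  proof (intro exI[of _ "k\<^sub>1 + k\<^sub>2 + k\<^sub>3"] conjI)
    show "\<not> order_property ?D 1 q (map_fm Inl \<theta>) (k\<^sub>1 + k\<^sub>2 + k\<^sub>3)"
      by (rule contrapos_nn[OF k1]) (erule order_property_antimono, simp)
    show "\<not> order_property ?D 1 q (Neg (map_fm Inl \<theta>)) (k\<^sub>1 + k\<^sub>2 + k\<^sub>3)"
      by (rule contrapos_nn[OF k2]) (erule order_property_antimono, simp)
    show "\<not> order_property ?D q q (link q \<theta>) (k\<^sub>1 + k\<^sub>2 + k\<^sub>3)"
      by (rule contrapos_nn[OF k3]) (erule order_property_antimono, simp)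
  qed
qed

text \<open>Two exceptions next to many good positions would yield the configuration
  \<open>two_exceptions\<close> of size \<open>N\<close>, which stability forbids. Allowing every
  \<open>k \<ge> N\<close> lets a single \<open>k\<close> serve all types later.\<close>

lemma at_most_one_exception:
  assumes C: "\<forall>M \<in> C. structure_over \<Sigma> M" "monadically_stable \<Sigma> C"
    and \<Phi>: "\<forall>\<phi> \<in> \<Phi>. fm_over \<Sigma> (Suc q) \<phi>" and \<theta>: "\<theta> \<in> bool_combs \<Phi>"
  shows "\<exists>N. \<forall>k \<ge> N. \<forall>M \<in> C. \<forall>n \<ge> k. \<forall>I. \<forall>a \<in> universe M.
    (\<forall>i \<in> {1..n}. I i \<in> tuples M q) \<and> (\<forall>\<gamma> \<in> Delta q \<Phi> k. indiscernible M n I \<gamma>) \<and>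
    3 * k \<le> card {l \<in> {1..n}. sat M (a # I l) \<theta>} \<longrightarrow>
    (\<forall>p\<^sub>1 \<in> {1..n}. \<forall>p\<^sub>2 \<in> {1..n}. p\<^sub>1 < p\<^sub>2 \<longrightarrow> sat M (a # I p\<^sub>1) \<theta> \<or> sat M (a # I p\<^sub>2) \<theta>)"
proof -
  have \<theta>': "fm_over \<Sigma> (Suc q) \<theta>"
    using fm_over_bool_combs[OF \<theta> \<Phi>] .
  obtain m where m: "\<not> order_property (markings \<Sigma> C) 1 q (map_fm Inl \<theta>) m"
    "\<not> order_property (markings \<Sigma> C) 1 q (Neg (map_fm Inl \<theta>)) m"
    "\<not> order_property (markings \<Sigma> C) q q (link q \<theta>) m"
    using monadically_stable_bound[OF C(2) \<theta>'] by blast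
  obtain N where N: "\<And>M J c. M \<in> C \<Longrightarrow> \<forall>l < N. J l \<in> tuples M q \<Longrightarrow>
    \<forall>i j. i < j \<and> j < N \<longrightarrow> c i j \<in> universe M \<Longrightarrow>
    \<not> two_exceptions (\<lambda>i j l. sat M (c i j # J l) \<theta>) N"
    using order_property_two_exceptions[OF \<theta>', of C m] m C(1) by blast
  show ?thesis
  proof (intro exI[of _ N] allI ballI impI, elim conjE, rule ccontr)
    fix k M n I a p\<^sub>1 p\<^sub>2
    assume k: "N \<le> k" "k \<le> n" and M: "M \<in> C" and a: "a \<in> universe M"
      and I: "\<forall>i \<in> {1..n}. I i \<in> tuples M q"
      and ind: "\<forall>\<gamma> \<in> Delta q \<Phi> k. indiscernible M n I \<gamma>"
      and many: "3 * k \<le> card {l \<in> {1..n}. sat M (a # I l) \<theta>}"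
      and p: "p\<^sub>1 \<in> {1..n}" "p\<^sub>2 \<in> {1..n}" "p\<^sub>1 < p\<^sub>2"
      and "\<not> (sat M (a # I p\<^sub>1) \<theta> \<or> sat M (a # I p\<^sub>2) \<theta>)"
    have "Delta q \<Phi> N \<subseteq> Delta q \<Phi> k"
      unfolding Delta_def using k(1) by (blast intro: order_trans)
    then have "\<forall>\<gamma> \<in> Delta q \<Phi> N. indiscernible M n I \<gamma>"
      using ind by blast
    moreover have "N \<le> n" "3 * N \<le> card {l \<in> {1..n}. sat M (a # I l) \<theta>}"
      using k many by linarith+
    ultimately obtain c where c: "\<forall>i j. i < j \<and> j < N \<longrightarrow> c i j \<in> universe M"
      "two_exceptions (\<lambda>i j l. sat M (c i j # I (Suc l)) \<theta>) N"
      using indiscernible_two_exceptions[OF \<Phi> \<theta> I _ a _ p]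
        \<open>\<not> (sat M (a # I p\<^sub>1) \<theta> \<or> sat M (a # I p\<^sub>2) \<theta>)\<close> by blast
    have J: "\<forall>l < N. I (Suc l) \<in> tuples M q"
      using I \<open>N \<le> n\<close> by auto
    show False
      using N[where J = "\<lambda>l. I (Suc l)", OF M J c(1)] c(2) by contradiction
  qed
qed

theorem theorem3p4:
  fixes \<Sigma> :: "'r signature" and C :: "('a, 'r) struct set"
    and q :: nat and \<Phi> :: "'r fm set"
  assumes "\<forall>M \<in> C. structure_over \<Sigma> M"
    and "monadically_stable \<Sigma> C"
    and "finite \<Phi>" and "\<forall>\<phi> \<in> \<Phi>. fm_over \<Sigma> (Suc q) \<phi>"
  shows "\<exists>n\<^sub>0 k. \<forall>M \<in> C. \<forall>n \<ge> n\<^sub>0. \<forall>I :: nat \<Rightarrow> 'a list. \<forall>a \<in> universe M.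
    (\<forall>i \<in> {1..n}. I i \<in> tuples M q) \<and> (\<forall>\<gamma> \<in> Delta q \<Phi> k. indiscernible M n I \<gamma>) \<longrightarrow>
    (\<exists>ex \<in> {1..n}. \<exists>\<tau> \<in> types \<Phi>. \<forall>i \<in> {1..n}. i \<noteq> ex \<longrightarrow> sat M (a # I i) \<tau>)"
proof -
  have "\<forall>A \<in> Pow \<Phi>. \<exists>\<tau>. \<tau> \<in> types \<Phi> \<and>
      (\<forall>(M :: ('a, 'r) struct) e. {\<phi> \<in> \<Phi>. sat M e \<phi>} = A \<longrightarrow> sat M e \<tau>)"
    by (intro ballI ex_type[OF assms(3)]) simp
  from bchoice[OF this] obtain \<tau> where \<tau>_spec: "\<forall>A \<in> Pow \<Phi>. \<tau> A \<in> types \<Phi> \<and>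
      (\<forall>(M :: ('a, 'r) struct) e. {\<phi> \<in> \<Phi>. sat M e \<phi>} = A \<longrightarrow> sat M e (\<tau> A))" ..
  note \<tau> = bspec[OF \<tau>_spec, THEN conjunct1]
    and \<tau>_sat = bspec[OF \<tau>_spec, THEN conjunct2, rule_format]
  have "\<forall>A \<in> Pow \<Phi>. \<exists>N. \<forall>k \<ge> N. \<forall>M \<in> C. \<forall>n \<ge> k. \<forall>I. \<forall>a \<in> universe M.
    (\<forall>i \<in> {1..n}. I i \<in> tuples M q) \<and> (\<forall>\<gamma> \<in> Delta q \<Phi> k. indiscernible M n I \<gamma>) \<and>
    3 * k \<le> card {l \<in> {1..n}. sat M (a # I l) (\<tau> A)} \<longrightarrow>
    (\<forall>p\<^sub>1 \<in> {1..n}. \<forall>p\<^sub>2 \<in> {1..n}. p\<^sub>1 < p\<^sub>2 \<longrightarrow>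
       sat M (a # I p\<^sub>1) (\<tau> A) \<or> sat M (a # I p\<^sub>2) (\<tau> A))"
    using at_most_one_exception[OF assms(1,2,4)] \<tau> types_subset_bool_combs[of \<Phi>] by blast
  from bchoice[OF this] obtain N where N: "\<forall>A \<in> Pow \<Phi>. \<forall>k \<ge> N A. \<forall>M \<in> C. \<forall>n \<ge> k. \<forall>I. \<forall>a \<in> universe M.
    (\<forall>i \<in> {1..n}. I i \<in> tuples M q) \<and> (\<forall>\<gamma> \<in> Delta q \<Phi> k. indiscernible M n I \<gamma>) \<and>
    3 * k \<le> card {l \<in> {1..n}. sat M (a # I l) (\<tau> A)} \<longrightarrow>
    (\<forall>p\<^sub>1 \<in> {1..n}. \<forall>p\<^sub>2 \<in> {1..n}. p\<^sub>1 < p\<^sub>2 \<longrightarrow>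
       sat M (a # I p\<^sub>1) (\<tau> A) \<or> sat M (a # I p\<^sub>2) (\<tau> A))" ..
  \<comment> \<open>One \<open>k\<close> for the finitely many types. The \<open>+ 1\<close> makes
    \<open>n\<^sub>0\<close> positive, so that \<open>1\<close> is always an index.\<close>
  define k where "k = Max (N ` Pow \<Phi>) + 1"
  \<comment> \<open>With at most \<open>card (Pow \<Phi>)\<close> types along the sequence, some
    type then occurs at least \<open>3 * k\<close> times.\<close>
  define n\<^sub>0 where "n\<^sub>0 = 3 * k * card (Pow \<Phi>)"
  have fin: "finite (Pow \<Phi>)"
    using assms(3) by simp
  have Nk: "N A \<le> k" if "A \<in> Pow \<Phi>" for A
    unfolding k_def using that fin by (intro trans_le_add1 Max_ge) auto
  have card_pos: "card (Pow \<Phi>) > 0"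
    using fin by (auto simp: card_gt_0_iff)
  then have "3 * k \<le> n\<^sub>0"
    unfolding n\<^sub>0_def by (cases "card (Pow \<Phi>)") auto
  then have kn: "k \<le> n\<^sub>0" "1 \<le> n\<^sub>0"
    by (auto simp: k_def)
  show ?thesis
  proof (rule exI[of _ n\<^sub>0], rule exI[of _ k], intro ballI allI impI, elim conjE)
    fix M n a and I :: "nat \<Rightarrow> 'a list"
    assume M: "M \<in> C" and n: "n\<^sub>0 \<le> n" and a: "a \<in> universe M"
      and I: "\<forall>i \<in> {1..n}. I i \<in> tuples M q"
      and ind: "\<forall>\<gamma> \<in> Delta q \<Phi> k. indiscernible M n I \<gamma>"
    define tp where "tp l = {\<phi> \<in> \<Phi>. sat M (a # I l) \<phi>}" for l
    have "tp \<in> {1..n} \<rightarrow> Pow \<Phi>"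
      by (auto simp: tp_def)
    from pigeonhole_card[OF this _ fin] obtain A where A: "A \<in> Pow \<Phi>"
      and card: "card {1..n} \<le> card (tp -` {A} \<inter> {1..n}) * card (Pow \<Phi>)"
      by auto
    have "3 * k * card (Pow \<Phi>) \<le> card (tp -` {A} \<inter> {1..n}) * card (Pow \<Phi>)"
      by (rule order_trans[OF n[unfolded n\<^sub>0_def] card[unfolded card_atLeastAtMost diff_Suc_1]])
    then have "3 * k \<le> card (tp -` {A} \<inter> {1..n})"
      using card_pos by (meson mult_le_cancel2)
    also have "\<dots> \<le> card {l \<in> {1..n}. sat M (a # I l) (\<tau> A)}"
      using \<tau>_sat[OF A] by (intro card_mono) (auto simp: tp_def)
    finally have many: "3 * k \<le> card {l \<in> {1..n}. sat M (a # I l) (\<tau> A)}" .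
    have one: "sat M (a # I p\<^sub>1) (\<tau> A) \<or> sat M (a # I p\<^sub>2) (\<tau> A)"
      if "p\<^sub>1 \<in> {1..n}" "p\<^sub>2 \<in> {1..n}" "p\<^sub>1 < p\<^sub>2" for p\<^sub>1 p\<^sub>2
      using N[rule_format, OF A Nk[OF A] M _ a _ that] I ind many kn(1) n by simp
    show "\<exists>ex \<in> {1..n}. \<exists>\<tau> \<in> types \<Phi>. \<forall>i \<in> {1..n}. i \<noteq> ex \<longrightarrow> sat M (a # I i) \<tau>"
    proof (cases "\<exists>p \<in> {1..n}. \<not> sat M (a # I p) (\<tau> A)")
      case True
      then obtain p where p: "p \<in> {1..n}" "\<not> sat M (a # I p) (\<tau> A)"
        by blast
      then have "\<forall>i \<in> {1..n}. i \<noteq> p \<longrightarrow> sat M (a # I i) (\<tau> A)"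
        using one by (metis linorder_neqE_nat)
      with p(1) \<tau>[OF A] show ?thesis
        by blast
    next
      \<comment> \<open>Without any exception, index \<open>1\<close> serves as the default for
        \<open>ex\<close>.\<close>
      case False
      moreover have "1 \<in> {1..n}"
        using kn(2) n by simp
      ultimately show ?thesis
        using \<tau>[OF A] by blast
    qed
  qed
qed

end
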